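(* Let $q>2$ be a prime power and let $n\ge0$ be an integer. Then the multizeta value $\zeta_A(1,q^2-1,(q-1)q^2,(q-1)q^3,\dots,(q-1)q^{n+1})$ (of depth $n+2$ and weight $q^{n+2}$) is zeta-like; more precisely, $$\zeta_A(1,q^2-1,(q-1)q^2,\dots,(q-1)q^{n+1})=\frac{(-1)^{n+1}([n+2]-1)}{[1]\,[n+2]}\cdot\frac{1}{\prod_{k=1}^{n}[k]^{q^{n+2-k}}}\,\zeta_A(q^{n+2}).$$
   Context: $A=\mathbb{F}_q[\theta]$, $A_+$ the monic polynomials, $K=\mathbb{F}_q(\theta)$, $[k]=\theta^{q^k}-\theta$. For $s\in\mathbb{Z}$, $d\ge0$ let $S_d(s)=\sum_{a\in A_+,\deg a=d}a^{-s}$. For positive integers $s_1,\dots,s_r$, the Thakur multizeta value is $\zeta_A(s_1,\dots,s_r)=\sum_{d_1>\cdots>d_r\ge0}S_{d_1}(s_1)\cdots S_{d_r}(s_r)\in\mathbb{F}_q((1/\theta))$, and $\zeta_A(k)=\sum_{a\in A_+}a^{-k}$. A multizeta value of weight $w=\sum s_i$ is called zeta-like if $\zeta_A(s_1,\dots,s_r)/\zeta_A(w)\in K$. For $n=0$ the tuple is $(1,q^2-1)$ and the empty product is $1$. *)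

theory Defs
  imports
    "HOL-Library.Cardinality"
    "HOL-Analysis.Infinite_Sum"
    "HOL-Computational_Algebra.Formal_Laurent_Series"
begin

text \<open>
  The field \<open>\<bbbF>\<^sub>q\<close> is a type \<open>'a\<close> of classes \<open>field\<close> and \<open>finite\<close>, with \<open>q = CARD('a)\<close>, and
  \<open>A = \<bbbF>\<^sub>q[\<theta>]\<close> is \<^typ>\<open>'a poly\<close>.  The completion \<open>\<bbbF>\<^sub>q((1/\<theta>))\<close> is \<^typ>\<open>'a fls\<close> with
  \<^const>\<open>fls_X\<close> read as \<open>1/\<theta>\<close>, so \<open>\<theta>\<close> itself is \<^const>\<open>fls_X_inv\<close>; the library metric on
  \<^typ>\<open>'a fls\<close> gives exactly the \<open>1/\<theta>\<close>-adic topology.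
\<close>

definition theta :: "'a::field fls" where
  "theta = fls_X_inv"

definition of_A :: "'a::field poly \<Rightarrow> 'a fls" where
  "of_A a = poly (map_poly fls_const a) theta"

definition K_set :: "'a::field fls set" where
  "K_set = {of_A a / of_A b | a b. b \<noteq> 0}"

definition bracket :: "nat \<Rightarrow> 'a::{field,finite} fls" where
  "bracket k = theta ^ (CARD('a) ^ k) - theta"

definition A_plus :: "'a::field poly set" where
  "A_plus = {a. lead_coeff a = 1}"

definition power_sum :: "nat \<Rightarrow> int \<Rightarrow> 'a::{field,finite} fls" where
  "power_sum d s = (\<Sum>a | a \<in> A_plus \<and> degree a = d. of_A a powi (- s))"

definition decreasing_tuples :: "nat \<Rightarrow> nat list set" where
  "decreasing_tuples r = {ds. length ds = r \<and> sorted_wrt (>) ds}"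

definition multizeta :: "nat list \<Rightarrow> 'a::{field,finite} fls" where
  "multizeta s =
     (\<Sum>\<^sub>\<infinity>ds\<in>decreasing_tuples (length s). \<Prod>i<length s. power_sum (ds ! i) (int (s ! i)))"

definition zeta :: "nat \<Rightarrow> 'a::{field,finite} fls" where
  "zeta k = (\<Sum>\<^sub>\<infinity>a\<in>A_plus. of_A a powi (- int k))"

definition zeta_like :: "'a::{field,finite} itself \<Rightarrow> nat list \<Rightarrow> bool" where
  "zeta_like _ s \<longleftrightarrow> multizeta s / zeta (sum_list s) \<in> (K_set :: 'a fls set)"

text \<open>
  \<^const>\<open>infsum\<close> is \<open>0\<close> for a family that is not summable.  The lemmas below show that this
  default never occurs: the families defining \<^const>\<open>zeta\<close> and \<^const>\<open>multizeta\<close> are summable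
  for positive arguments.
\<close>

lemma finite_A_plus_degree: "finite {a \<in> (A_plus :: 'a::{field,finite} poly set). degree a < n}"
proof -
  have "{a \<in> (A_plus :: 'a poly set). degree a < n}
          \<subseteq> Poly ` {xs. set xs \<subseteq> UNIV \<and> length xs \<le> n}"
  proof
    fix a :: "'a poly" assume "a \<in> {a \<in> A_plus. degree a < n}"
    then have "length (coeffs a) \<le> n"
      by (cases "a = 0") (auto simp: length_coeffs_degree)
    then show "a \<in> Poly ` {xs. set xs \<subseteq> UNIV \<and> length xs \<le> n}"
      by (intro image_eqI[of _ _ "coeffs a"]) auto
  qed
  then show ?thesis
    by (rule finite_subset) (intro finite_imageI finite_lists_length_le, simp)
qed

context includes fps_syntax begin

lemma of_A_nth: "of_A a $$ m = (if m \<le> 0 then coeff a (nat (- m)) else 0)"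
proof (induction a arbitrary: m)
  case 0
  then show ?case by (simp add: of_A_def)
next
  case (pCons c p)
  have "of_A (pCons c p) = fls_const c + fls_X_inv * of_A p"
    by (cases "p = 0 \<and> c = 0") (auto simp: of_A_def theta_def map_poly_pCons)
  then have "of_A (pCons c p) $$ m = (if m = 0 then c else 0) + of_A p $$ (m + 1)"
    by (simp add: fls_X_inv_times_conv_shift)
  then show ?case
    using pCons.IH[of "m + 1"]
    by (auto simp: coeff_pCons nat_eq_iff split: nat.splits)
qed

lemma of_A_subdegree: "fls_subdegree (of_A a) = - int (degree a)"
proof (cases "a = 0")
  case True
  then show ?thesis by (simp add: of_A_def)
next
  case False
  show ?thesis
    by (rule fls_subdegree_eqI) (use False in \<open>auto simp: of_A_nth intro: coeff_eq_0\<close>)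
qed

lemma of_A_eq_0_iff [simp]: "of_A a = 0 \<longleftrightarrow> a = 0"
proof
  assume "of_A a = 0"
  then have "coeff a n = 0" for n using of_A_nth[of a "- int n"] by simp
  then show "a = 0" by (simp add: poly_eqI)
qed (simp add: of_A_def)

lemma fls_summable_onI:
  fixes f :: "'i \<Rightarrow> 'b::ab_group_add fls"
  assumes fin: "\<And>n. finite {x \<in> A. \<exists>m<n. f x $$ m \<noteq> 0}"
  shows "f summable_on A"
proof -
  define F where "F n = {x \<in> A. \<exists>m<n. f x $$ m \<noteq> 0}" for n :: int
  define g where "g n = (\<Sum>x\<in>F (n + 1). f x $$ n)" for n :: int
  have finF: "finite (F n)" for n using fin by (simp add: F_def)
  have sum_eq: "(\<Sum>x\<in>X. f x) $$ m = g m" if "finite X" "F n \<subseteq> X" "X \<subseteq> A" "m < n" for X n m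
  proof -
    have "(\<Sum>x\<in>X. f x) $$ m = (\<Sum>x\<in>X. f x $$ m)"
      by (induction X rule: infinite_finite_induct) auto
    also have "\<dots> = g m" unfolding g_def
    proof (rule sum.mono_neutral_right)
      have "F (m + 1) \<subseteq> F n" unfolding F_def using that(4)
        by clarsimp (metis le_less_trans)
      then show "F (m + 1) \<subseteq> X" using that(2) by blast
      show "\<forall>i\<in>X - F (m + 1). f i $$ m = 0" using that by (auto simp: F_def)
    qed (use that in auto)
    finally show ?thesis .
  qed
  have "g m = (\<Sum>x\<in>F 0. f x) $$ m" if "m < 0" for m
    by (rule sum_eq[symmetric, of _ 0]) (use that finF in \<open>auto simp: F_def\<close>)
  then have "g m = 0" if "m < min 0 (fls_subdegree (\<Sum>x\<in>F 0. f x))" for m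
    using that by simp
  then have nth: "Abs_fls g $$ n = g n" for n
    by (metis nth_Abs_fls_lower_bound)
  have "((\<lambda>X. sum f X) \<longlongrightarrow> Abs_fls g) (finite_subsets_at_top A)"
  proof (rule tendstoI)
    fix e :: real assume "e > 0"
    then obtain k :: nat where k: "inverse (2 ^ k) < e"
      using real_arch_pow_inv[of e "1/2"] by (auto simp: power_one_over inverse_eq_divide)
    have "dist (sum f X) (Abs_fls g) < e" if X: "finite X" "F (int k) \<subseteq> X" "X \<subseteq> A" for X
    proof (cases "sum f X = Abs_fls g")
      case False
      have "(sum f X - Abs_fls g) $$ m = 0" if "m < int k" for m
        using sum_eq[OF X that] by (simp add: nth)
      then have "fls_subdegree (sum f X - Abs_fls g) \<ge> int k"
        using False by (metis eq_iff_diff_eq_0 fls_subdegree_geI)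
      then have "2 ^ k \<le> (2::real) ^ nat (fls_subdegree (sum f X - Abs_fls g))"
        by (intro power_increasing) auto
      then have "dist (sum f X) (Abs_fls g) \<le> inverse (2 ^ k)"
        using False \<open>fls_subdegree (sum f X - Abs_fls g) \<ge> int k\<close>
        by (auto simp: dist_fls_def le_imp_inverse_le)
      with k show ?thesis by simp
    qed (use \<open>e > 0\<close> in simp)
    then show "\<forall>\<^sub>F X in finite_subsets_at_top A. dist (sum f X) (Abs_fls g) < e"
      unfolding eventually_finite_subsets_at_top
      using finF[of "int k"] by (intro exI[of _ "F (int k)"]) (auto simp: F_def)
  qed
  then show ?thesis by (auto simp: summable_on_def has_sum_def)
qed

lemma of_A_powi_nth_eq_0:
  assumes "a \<in> A_plus" "m < int (degree a) * s"
  shows "(of_A a powi (- s)) $$ m = 0"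
proof -
  have "fls_subdegree (of_A a powi (- s)) = int (degree a) * s"
    by (simp add: fls_subdegree_power_int of_A_subdegree)
  with assms show ?thesis by simp
qed

lemma zeta_summable:
  assumes "k > 0"
  shows "(\<lambda>a. of_A a powi (- int k) :: 'a::{field,finite} fls) summable_on A_plus"
proof (rule fls_summable_onI)
  fix n :: int
  have "degree a < nat n" if a: "a \<in> A_plus" "m < n" "(of_A a powi (- int k)) $$ m \<noteq> 0"
    for a :: "'a poly" and m
  proof -
    have "int (degree a) * int k \<le> m" using of_A_powi_nth_eq_0 a by (metis not_less)
    moreover have "int (degree a) * 1 \<le> int (degree a) * int k"
      using assms by (intro mult_left_mono) auto
    ultimately show ?thesis using a by linarith
  qed
  then have "{a \<in> A_plus. \<exists>m<n. (of_A a powi (- int k) :: 'a fls) $$ m \<noteq> 0}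
               \<subseteq> {a \<in> A_plus. degree a < nat n}" by blast
  then show "finite {a \<in> A_plus. \<exists>m<n. (of_A a powi (- int k) :: 'a fls) $$ m \<noteq> 0}"
    by (rule finite_subset) (rule finite_A_plus_degree)
qed

lemma power_sum_nth_eq_0:
  assumes "m < int d * s"
  shows "(power_sum d s :: 'a::{field,finite} fls) $$ m = 0"
proof -
  have "(\<Sum>a\<in>X. of_A a powi (- s)) $$ m = (\<Sum>a\<in>X. (of_A a powi (- s)) $$ m)" for X :: "'a poly set"
    by (induction X rule: infinite_finite_induct) auto
  then show ?thesis
    unfolding power_sum_def using assms by (auto intro!: sum.neutral of_A_powi_nth_eq_0)
qed

lemma multizeta_summable:
  assumes "\<forall>x\<in>set s. x > 0"
  shows "(\<lambda>ds. \<Prod>i<length s. power_sum (ds ! i) (int (s ! i)) :: 'a::{field,finite} fls)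
           summable_on decreasing_tuples (length s)"
proof (rule fls_summable_onI)
  fix n :: int
  let ?f = "\<lambda>ds. \<Prod>i<length s. power_sum (ds ! i) (int (s ! i)) :: 'a fls"
  have bound: "set ds \<subseteq> {..<nat n}"
    if ds: "ds \<in> decreasing_tuples (length s)" and m: "m < n" "?f ds $$ m \<noteq> 0" for ds m
  proof
    fix d assume "d \<in> set ds"
    with ds obtain j where j: "j < length s" "d = ds ! j"
      by (auto simp: decreasing_tuples_def in_set_conv_nth)
    have nz: "?f ds \<noteq> 0" using m(2) by (metis fls_zero_nth)
    then have nz': "(power_sum (ds ! i) (int (s ! i)) :: 'a fls) \<noteq> 0" if "i < length s" for i
      using that by (metis finite_lessThan lessThan_iff prod_zero)
    have deg: "fls_subdegree (\<Prod>i\<in>I. power_sum (ds ! i) (int (s ! i)) :: 'a fls) \<ge> (\<Sum>i\<in>I. int (ds ! i))"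
      if "I \<subseteq> {..<length s}" "finite I" for I
      using that(2,1)
    proof (induction I rule: finite_induct)
      case (insert i I)
      have "1 \<le> int (s ! i)" using assms insert.prems by (force simp: set_conv_nth)
      then have "int (ds ! i) * 1 \<le> int (ds ! i) * int (s ! i)" by (intro mult_left_mono) auto
      moreover have "fls_subdegree (power_sum (ds ! i) (int (s ! i)) :: 'a fls) \<ge> int (ds ! i) * int (s ! i)"
        using insert.prems nz' by (intro fls_subdegree_geI power_sum_nth_eq_0) auto
      moreover have "(\<Prod>i\<in>I. power_sum (ds ! i) (int (s ! i)) :: 'a fls) \<noteq> 0"
        using insert nz' by (subst prod_zero_iff) auto
      ultimately show ?case using insert nz'[of i] by (simp add: fls_subdegree_mult)
    qed simp
    have "int d \<le> (\<Sum>i<length s. int (ds ! i))"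
      using j member_le_sum[of j "{..<length s}" "\<lambda>i. int (ds ! i)"] by simp
    also have "\<dots> \<le> fls_subdegree (?f ds)" using deg by simp
    also have "\<dots> \<le> m" using m by (intro fls_subdegree_leI)
    finally show "d \<in> {..<nat n}" using m by simp
  qed
  have "{ds \<in> decreasing_tuples (length s). \<exists>m<n. ?f ds $$ m \<noteq> 0}
          \<subseteq> {ds. set ds \<subseteq> {..<nat n} \<and> length ds = length s}"
  proof
    fix ds assume "ds \<in> {ds \<in> decreasing_tuples (length s). \<exists>m<n. ?f ds $$ m \<noteq> 0}"
    then show "ds \<in> {ds. set ds \<subseteq> {..<nat n} \<and> length ds = length s}"
      using bound by (simp add: decreasing_tuples_def) blast
  qed
  then show "finite {ds \<in> decreasing_tuples (length s). \<exists>m<n. ?f ds $$ m \<noteq> 0}"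
    by (rule finite_subset) (intro finite_lists_length_eq, simp)
qed

end

end

theory Submission
  imports Defs
begin

text \<open>
  Write \<open>\<ell>\<^sub>d = \<Prod>\<^sub>1\<^sub>\<le>\<^sub>i\<^sub>\<le>\<^sub>d (\<theta> - \<theta>^(q^i))\<close>.  Carlitz's polynomial \<open>E\<^sub>d\<close>, given by \<open>E\<^sub>0 = z\<close> and
  \<open>[d+1] E\<^bsub>d+1\<^esub> = E\<^sub>d^q - E\<^sub>d\<close>, is additive and takes the value \<open>1\<close> exactly at the monic polynomials of
  degree \<open>d\<close>.  Up to sign, the logarithmic derivative of \<open>1 - E\<^sub>d\<close> is therefore the generating function of the
  power sums \<open>S\<^sub>d(k)\<close>; comparing coefficients and using \<open>S\<^sub>d(q k) = S\<^sub>d(k)^q\<close> gives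
  \<open>S\<^sub>d(1) = 1/\<ell>\<^sub>d\<close>, \<open>S\<^sub>d(q-1) = 1/\<ell>\<^sub>d^(q-1)\<close> and \<open>S\<^sub>d(q\<^sup>2-1) = \<ell>\<^bsub>d+1\<^esub> / (\<ell>\<^sub>1 \<ell>\<^sub>d^(q\<^sup>2))\<close>.
  With these values every inner sum of the multizeta value telescopes, because
  \<open>\<ell>\<^bsub>d+1\<^esub>/\<ell>\<^bsub>d+1-m\<^esub>^(q^m) - \<ell>\<^sub>d/\<ell>\<^bsub>d-m\<^esub>^(q^m)\<close> is \<open>-[m] \<ell>\<^sub>d/\<ell>\<^bsub>d+1-m\<^esub>^(q^m)\<close>.  The outermost sum becomes a
  multiple of the series \<open>\<Sum>\<^sub>e (\<theta> - \<theta>^(q^(e+n+2))) / \<ell>\<^sub>e^(q^(n+2))\<close>, whose \<open>e\<close>-th partial sum differs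
  from that of \<open>(1 - [n+2]) \<zeta>(q^(n+2))\<close> by \<open>1/\<ell>\<^sub>e^(q^(n+2))\<close>, which tends to \<open>0\<close>.
\<close>

subsection \<open>The Frobenius map\<close>

lemma card_field_ge_2: "CARD('a::{field,finite}) \<ge> 2"
proof -
  have "card {0, 1 :: 'a} \<le> CARD('a)" by (intro card_mono) auto
  then show ?thesis by simp
qed

text \<open>Multiplication by a nonzero \<open>x\<close> permutes the nonzero elements; comparing
  the products over them gives \<open>x ^ (q - 1) = 1\<close>.\<close>

lemma finite_field_power_card:
  fixes x :: "'a::{field,finite}"
  shows "x ^ CARD('a) = x"
proof (cases "x = 0")
  case True
  then show ?thesis using card_field_ge_2[where 'a = 'a] by (simp add: power_0_left)
next
  case False
  have "(\<Prod>y\<in>UNIV-{0}. x * y) = x ^ (CARD('a) - 1) * \<Prod>(UNIV-{0})"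
    by (simp add: prod.distrib)
  moreover have "(\<Prod>y\<in>UNIV-{0}. x * y) = (\<Prod>y\<in>UNIV-{0}. y)"
    by (rule prod.reindex_bij_witness[of _ "\<lambda>y. y / x" "\<lambda>y. x * y"]) (use False in auto)
  ultimately have "x ^ (CARD('a) - 1) = 1" by simp
  then show ?thesis
    using card_field_ge_2[where 'a = 'a] power_minus_mult[of "CARD('a)" x] by simp
qed

text \<open>\<open>(X + 1)\<^sup>q\<close> and \<open>X\<^sup>q + 1\<close> are monic of degree \<open>q\<close> and agree at all \<open>q\<close> points of the field.\<close>

lemma of_nat_card_choose_eq_0:
  assumes "0 < i" "i < CARD('a::{field,finite})"
  shows "of_nat (CARD('a) choose i) = (0 :: 'a)"
proof -
  let ?q = "CARD('a)"
  have q: "?q > 0" by simp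
  have "[:1, 1:] ^ ?q = monom 1 ?q + (1 :: 'a poly)"
  proof (rule poly_eqI_degree_lead_coeff[where A = UNIV and n = ?q])
    show "degree ([:1, 1:] ^ ?q :: 'a poly) \<le> ?q"
      by (simp add: degree_power_eq)
    show "coeff ([:1, 1:] ^ ?q) ?q = coeff (monom 1 ?q + (1 :: 'a poly)) ?q"
      using coeff_linear_power[of "1::'a" ?q] q by simp
    show "degree (monom 1 ?q + (1 :: 'a poly)) \<le> ?q"
      by (intro degree_add_le) (auto simp: degree_monom_le)
    show "poly ([:1, 1:] ^ ?q) z = poly (monom 1 ?q + 1) z" for z :: 'a
      by (simp add: poly_monom finite_field_power_card)
  qed simp
  then have "coeff ([:1, 1:] ^ ?q :: 'a poly) i = 0"
    using assms by simp
  then show ?thesis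
    using assms by (simp add: coeff_linear_poly_power)
qed

text \<open>Only the two extreme binomial terms survive. The general semiring makes this serve both
  Laurent series and polynomials over them.\<close>

lemma power_add_of_choose_eq_0:
  fixes x y :: "'b::comm_semiring_1"
  assumes "q > 0" and "\<And>i. 0 < i \<Longrightarrow> i < q \<Longrightarrow> of_nat (q choose i) = (0 :: 'b)"
  shows "(x + y) ^ q = x ^ q + y ^ q"
proof -
  have "(x + y) ^ q = (\<Sum>k\<in>{0, q}. of_nat (q choose k) * x ^ k * y ^ (q - k))"
    unfolding binomial_ring using assms
    by (intro sum.mono_neutral_right) (auto simp: le_less)
  also have "\<dots> = x ^ q + y ^ q" using assms(1) by (simp add: add.commute)
  finally show ?thesis .
qed

lemma fls_frobenius_add:
  fixes x y :: "'a::{field,finite} fls"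
  shows "(x + y) ^ CARD('a) = x ^ CARD('a) + y ^ CARD('a)"
  by (rule power_add_of_choose_eq_0) (auto simp: fls_of_nat of_nat_card_choose_eq_0)

lemma fls_poly_frobenius_add:
  fixes x y :: "'a::{field,finite} fls poly"
  shows "(x + y) ^ CARD('a) = x ^ CARD('a) + y ^ CARD('a)"
  by (rule power_add_of_choose_eq_0)
     (auto simp: fls_of_nat of_nat_poly of_nat_card_choose_eq_0)

lemma fls_frobenius_diff:
  fixes x y :: "'a::{field,finite} fls"
  shows "(x - y) ^ CARD('a) = x ^ CARD('a) - y ^ CARD('a)"
  using fls_frobenius_add[of "x - y" y] by (simp add: algebra_simps)

lemma fls_frobenius_uminus:
  fixes x :: "'a::{field,finite} fls"
  shows "(- x) ^ CARD('a) = - (x ^ CARD('a))"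
  using fls_frobenius_diff[of 0 x] by (simp add: power_0_left)

lemma fls_frobenius_power_add:
  fixes x y :: "'a::{field,finite} fls"
  shows "(x + y) ^ (CARD('a) ^ j) = x ^ (CARD('a) ^ j) + y ^ (CARD('a) ^ j)"
  by (induction j) (simp_all add: power_Suc2 power_mult fls_frobenius_add del: power_Suc)

lemma fls_frobenius_power_diff:
  fixes x y :: "'a::{field,finite} fls"
  shows "(x - y) ^ (CARD('a) ^ j) = x ^ (CARD('a) ^ j) - y ^ (CARD('a) ^ j)"
  using fls_frobenius_power_add[of "x - y" y j] by (simp add: algebra_simps)

lemma fls_frobenius_power_uminus:
  fixes x :: "'a::{field,finite} fls"
  shows "(- x) ^ (CARD('a) ^ j) = - (x ^ (CARD('a) ^ j))"
  using fls_frobenius_power_diff[of 0 x j] by (simp add: power_0_left)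

lemma fls_frobenius_power_sum:
  fixes f :: "'i \<Rightarrow> 'a::{field,finite} fls"
  shows "(\<Sum>x\<in>X. f x) ^ (CARD('a) ^ j) = (\<Sum>x\<in>X. f x ^ (CARD('a) ^ j))"
  by (induction X rule: infinite_finite_induct) (simp_all add: fls_frobenius_power_add)

text \<open>By additivity of Frobenius, \<open>p ^ q\<close> raises each coefficient to the q-th
  power and stretches the exponents by \<open>q\<close>. The induction peels off the constant
  term.\<close>

lemma coeff_fls_poly_frobenius:
  fixes p :: "'a::{field,finite} fls poly"
  shows "coeff (p ^ CARD('a)) m =
    (if CARD('a) dvd m then coeff p (m div CARD('a)) ^ CARD('a) else 0)"
proof (induction p arbitrary: m)
  case 0
  then show ?case by (simp add: power_0_left)
next
  case (pCons c p)
  let ?q = "CARD('a)"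
  have "pCons c p = [:c:] + monom 1 1 * p"
    by (simp add: monom_altdef)
  then have "pCons c p ^ ?q = [:c ^ ?q:] + monom 1 ?q * p ^ ?q"
    by (simp add: fls_poly_frobenius_add power_mult_distrib monom_power poly_const_pow)
  then have *: "coeff (pCons c p ^ ?q) m =
      (if m = 0 then c ^ ?q else 0) + (if m < ?q then 0 else coeff (p ^ ?q) (m - ?q))"
    by (auto simp: coeff_monom_mult coeff_pCons split: nat.splits)
  show ?case
  proof (cases "m < ?q")
    case True
    then show ?thesis using * by (auto dest: dvd_imp_le)
  next
    case False
    then have "m div ?q = Suc ((m - ?q) div ?q)" "?q dvd m \<longleftrightarrow> ?q dvd (m - ?q)" "m \<noteq> 0"
      using zero_less_card_finite[where 'a = 'a]
      by (auto simp: le_div_geq dvd_minus_self simp del: zero_less_card_finite)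
    then show ?thesis using * False pCons.IH[of "m - ?q"] by simp
  qed
qed

subsection \<open>Carlitz polynomials\<close>

lemma of_A_pCons: "of_A (pCons c p) = fls_const c + theta * of_A p"
  by (cases "p = 0 \<and> c = 0") (auto simp: of_A_def map_poly_pCons)

lemma of_A_0 [simp]: "of_A 0 = 0"
  by simp

lemma of_A_inj: "inj of_A"
proof (rule injI)
  fix a b :: "'a poly"
  assume *: "of_A a = of_A b"
  have "coeff a n = coeff b n" for n
    using of_A_nth[of a "- int n"] of_A_nth[of b "- int n"] * by simp
  then show "a = b" by (rule poly_eqI)
qed

lemma theta_power_nth:
  "fls_nth (theta ^ k) m = (if m = - int k then 1 else 0)"
  by (simp add: theta_def fls_X_inv_power_conv_shift_1)

text \<open>Since \<open>q ^ k\<close> exceeds 1, the coefficient of \<open>theta\<close> itself is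
  -1.\<close>

lemma bracket_nonzero:
  assumes "k > 0"
  shows "bracket k \<noteq> (0 :: 'a::{field,finite} fls)"
proof
  assume *: "bracket k = (0 :: 'a fls)"
  have "CARD('a) ^ k > 1"
    using assms card_field_ge_2[where 'a = 'a] by (intro one_less_power) auto
  then have "int (CARD('a) ^ k) \<noteq> 1" by linarith
  then have "fls_nth (bracket k :: 'a fls) (-1) = -1"
    using theta_power_nth[of 1 "-1", where 'a = 'a] by (simp add: bracket_def theta_power_nth)
  with * show False by simp
qed

text \<open>Up to the sign \<open>(-1) ^ d\<close> this is Carlitz's L_d, the least common multiple
  of the monic polynomials of degree d.\<close>

definition carlitz_l :: "nat \<Rightarrow> 'a::{field,finite} fls" where
  "carlitz_l d = (\<Prod>i=1..d. - bracket i)"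

lemma carlitz_l_0 [simp]: "carlitz_l 0 = 1"
  by (simp add: carlitz_l_def)

lemma carlitz_l_Suc: "carlitz_l (Suc d) = - bracket (Suc d) * carlitz_l d"
  by (simp add: carlitz_l_def)

lemma carlitz_l_nonzero [simp]: "carlitz_l d \<noteq> 0"
  by (induction d) (simp_all add: carlitz_l_Suc bracket_nonzero)

text \<open>Carlitz's e_d(z)/D_d, where e_d(z) is the product of z - a over all a in A of degree
  below d (with 0 included) and D_d is the product of the monic polynomials of degree d.\<close>

primrec carlitz_poly :: "nat \<Rightarrow> 'a::{field,finite} fls poly" where
  "carlitz_poly 0 = [:0, 1:]"
| "carlitz_poly (Suc d) =
     smult (inverse (bracket (Suc d))) (carlitz_poly d ^ CARD('a) - carlitz_poly d)"

lemma bracket_times_poly_carlitz_Suc: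
  "bracket (Suc d) * poly (carlitz_poly (Suc d)) z =
     poly (carlitz_poly d) z ^ CARD('a) - poly (carlitz_poly d) (z :: 'a::{field,finite} fls)"
  by (simp add: bracket_nonzero)

lemma poly_carlitz_add:
  "poly (carlitz_poly d) (x + y) = poly (carlitz_poly d) x + poly (carlitz_poly d) y"
  by (induction d) (simp_all add: fls_frobenius_add algebra_simps)

lemma poly_carlitz_const_mult:
  fixes z :: "'a::{field,finite} fls"
  shows "poly (carlitz_poly d) (fls_const c * z) = fls_const c * poly (carlitz_poly d) z"
  by (induction d)
     (simp_all add: power_mult_distrib finite_field_power_card algebra_simps flip: fls_const_power)

lemma poly_carlitz_0 [simp]: "poly (carlitz_poly d) 0 = 0"
  by (induction d) (simp_all add: power_0_left)

lemma poly_carlitz_1: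
  assumes "d > 0"
  shows "poly (carlitz_poly d) 1 = 0"
  using assms
proof (induction d rule: nat_induct_non_zero)
  case 1
  then show ?case by simp
next
  case (Suc n)
  then show ?case by (simp add: power_0_left)
qed

lemma bracket_Suc_split:
  "bracket (Suc d) = bracket d ^ CARD('a) + theta ^ CARD('a) - (theta :: 'a::{field,finite} fls)"
  by (simp add: bracket_def fls_frobenius_diff mult.commute flip: power_mult)

text \<open>Together with additivity this evaluates the polynomials on A by Horner's rule. The
  induction clears the inverse bracket and uses the recursion at two consecutive levels.\<close>

lemma poly_carlitz_theta_mult:
  fixes z :: "'a::{field,finite} fls"
  shows "poly (carlitz_poly (Suc d)) (theta * z) =
    theta * poly (carlitz_poly (Suc d)) z + poly (carlitz_poly d) z ^ CARD('a)"
proof (induction d)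
  case 0
  have "bracket (Suc 0) * poly (carlitz_poly (Suc 0)) (theta * z) =
      bracket (Suc 0) * (theta * poly (carlitz_poly (Suc 0)) z + z ^ CARD('a))"
    unfolding distrib_left mult.left_commute[of "bracket _" theta] bracket_times_poly_carlitz_Suc
    by (simp add: bracket_def algebra_simps power_mult_distrib)
  then show ?case by (simp only: mult_cancel_left) (simp add: bracket_nonzero)
next
  case (Suc d)
  let ?q = "CARD('a)"
  let ?e = "\<lambda>d. poly (carlitz_poly d)"
  let ?B = "bracket (Suc d) :: 'a fls"
  have "bracket (Suc (Suc d)) * ?e (Suc (Suc d)) (theta * z) =
      (theta * ?e (Suc d) z + ?e d z ^ ?q) ^ ?q - (theta * ?e (Suc d) z + ?e d z ^ ?q)"
    unfolding bracket_times_poly_carlitz_Suc Suc.IH by (rule refl)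
  also have "\<dots> = theta ^ ?q * ?e (Suc d) z ^ ?q - theta * ?e (Suc d) z
      + ((?e d z ^ ?q) ^ ?q - ?e d z ^ ?q)"
    by (simp add: fls_frobenius_add power_mult_distrib del: carlitz_poly.simps)
  \<comment> \<open>The recursion for \<open>carlitz_poly (Suc d)\<close>, raised to the q-th
    power.\<close>
  also have "(?e d z ^ ?q) ^ ?q - ?e d z ^ ?q = ?B ^ ?q * ?e (Suc d) z ^ ?q"
    by (metis bracket_times_poly_carlitz_Suc fls_frobenius_diff power_mult_distrib)
  \<comment> \<open>By \<open>bracket_Suc_split\<close>,
    \<open>theta ^ q + bracket (Suc d) ^ q\<close> is
    \<open>theta + bracket (Suc (Suc d))\<close>.\<close>
  also have "theta ^ ?q * ?e (Suc d) z ^ ?q - theta * ?e (Suc d) z + ?B ^ ?q * ?e (Suc d) z ^ ?q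
      = theta * (?e (Suc d) z ^ ?q - ?e (Suc d) z)
        + bracket (Suc (Suc d)) * ?e (Suc d) z ^ ?q"
    unfolding bracket_Suc_split[of "Suc d"] by (simp add: algebra_simps del: carlitz_poly.simps)
  also have "\<dots> = bracket (Suc (Suc d)) *
      (theta * ?e (Suc (Suc d)) z + ?e (Suc d) z ^ ?q)"
    unfolding bracket_times_poly_carlitz_Suc[symmetric]
    by (simp add: algebra_simps del: carlitz_poly.simps)
  finally show ?case by (simp only: mult_cancel_left) (simp add: bracket_nonzero)
qed

text \<open>Horner's rule on \<open>c + theta * p\<close>: for positive d the constant
  \<open>c\<close> is killed, \<open>p\<close> has no coefficient in degree d, and the q-th power
  from \<open>poly_carlitz_theta_mult\<close> is the coefficient of \<open>p\<close> in degree d -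
  1, which Frobenius fixes.\<close>

lemma poly_carlitz_of_A:
  assumes "degree a \<le> d"
  shows "poly (carlitz_poly d) (of_A a) = fls_const (coeff (a :: 'a::{field,finite} poly) d)"
  using assms
proof (induction a arbitrary: d)
  case 0
  then show ?case by simp
next
  case (pCons c p)
  show ?case
  proof (cases d)
    case 0
    with pCons.prems have "p = 0" by (simp split: if_splits)
    then show ?thesis using 0 by (simp add: of_A_pCons)
  next
    case (Suc e)
    have deg: "degree p \<le> e" using pCons.prems Suc by (cases "p = 0") auto
    have "poly (carlitz_poly d) (fls_const c) = 0"
      using poly_carlitz_const_mult[of d c 1] poly_carlitz_1[of d, where 'a = 'a] Suc
      by (simp del: carlitz_poly.simps)
    moreover have "coeff p d = 0" using deg Suc by (intro coeff_eq_0) auto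
    ultimately show ?thesis
      using pCons.IH[of e] pCons.IH[of d] deg Suc
      by (simp add: of_A_pCons poly_carlitz_add poly_carlitz_theta_mult finite_field_power_card
          del: carlitz_poly.simps flip: fls_const_power)
  qed
qed

text \<open>A q-th power has derivative 0, so each step of the recursion only contributes the factor
  \<open>- inverse (bracket (Suc d))\<close>.\<close>

lemma pderiv_carlitz:
  "pderiv (carlitz_poly d) = [:inverse (carlitz_l d :: 'a::{field,finite} fls):]"
proof (induction d)
  case 0
  then show ?case by (simp add: pderiv_pCons)
next
  case (Suc d)
  have "of_nat CARD('a) = (0 :: 'a fls)"
  proof -
    have "of_nat CARD('a) = (0 :: 'a)"
      using of_nat_card_choose_eq_0[of 1, where 'a = 'a] card_field_ge_2[where 'a = 'a] by simp
    then show ?thesis by (simp add: fls_of_nat)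
  qed
  then have "pderiv (carlitz_poly d ^ CARD('a)) = (0 :: 'a fls poly)"
    by (simp add: pderiv_power)
  then show ?case
    using Suc by (simp add: pderiv_smult pderiv_diff carlitz_l_Suc)
qed

lemma degree_carlitz:
  "degree (carlitz_poly d :: 'a::{field,finite} fls poly) = CARD('a) ^ d"
proof (induction d)
  case 0
  then show ?case by simp
next
  case (Suc d)
  have nz: "carlitz_poly d \<noteq> (0 :: 'a fls poly)"
    using Suc by (metis degree_0 power_not_zero zero_less_card_finite less_numeral_extra(3))
  have "CARD('a) ^ d < CARD('a) ^ Suc d"
    using card_field_ge_2[where 'a = 'a] by (intro power_strict_increasing) auto
  then have "degree (carlitz_poly d ^ CARD('a) - carlitz_poly d :: 'a fls poly) = CARD('a) ^ Suc d"
    by (subst diff_conv_add_uminus, subst degree_add_eq_left)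
       (simp_all add: degree_power_eq Suc mult.commute nz)
  then show ?case by (simp add: bracket_nonzero)
qed

lemma coeff_carlitz_0: "coeff (carlitz_poly d) 0 = 0"
  using poly_carlitz_0[of d] by (simp add: poly_0_coeff_0)

text \<open>Only powers of q occur as exponents, hence just 1 and q below \<open>q^2\<close>; these
  suffice for the recurrences of S_d(q-1) and S_d(q^2-1). At d = 0 the two powers of
  \<open>theta\<close> coincide and the second formula gives 0.\<close>

lemma coeff_carlitz:
  assumes "m < CARD('a)\<^sup>2"
  shows "coeff (carlitz_poly d :: 'a::{field,finite} fls poly) m =
    (if m = 1 then inverse (carlitz_l d)
     else if m = CARD('a) then
       (theta ^ CARD('a) - theta ^ (CARD('a) ^ Suc d)) / (bracket 1 * carlitz_l d ^ CARD('a))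
     else 0)"
  using assms
proof (induction d arbitrary: m)
  case 0
  then show ?case by (auto simp: coeff_pCons split: nat.splits)
next
  case (Suc d)
  let ?q = "CARD('a)"
  have q: "?q \<ge> 2" by (rule card_field_ge_2)
  have lt: "k < ?q\<^sup>2" if "k \<le> ?q" for k
    using that q power2_eq_square[of ?q] mult_strict_left_mono[of 1 ?q ?q] by linarith
  have c: "coeff (carlitz_poly (Suc d)) m = inverse (bracket (Suc d)) *
      ((if ?q dvd m then coeff (carlitz_poly d) (m div ?q) ^ ?q else 0)
        - coeff (carlitz_poly d) m :: 'a fls)"
    by (simp add: coeff_fls_poly_frobenius)
  consider "m = 1" | "m = ?q" | "m \<noteq> 1" "m \<noteq> ?q" by blast
  then show ?case
  proof cases
    case 1
    then show ?thesis
      using c Suc.IH[of 1] lt[of 1] q by (simp add: carlitz_l_Suc del: carlitz_poly.simps)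
  next
    case 2
    \<comment> \<open>In these letters the step is field arithmetic governed by the relation
      \<open>yq\<close>.\<close>
    define x y w L :: "'a fls" where "x = theta ^ ?q" and "y = theta ^ (?q ^ Suc d)"
      and "w = theta ^ (?q ^ Suc (Suc d))" and "L = carlitz_l d ^ ?q"
    have B: "bracket (Suc 0) = x - theta" "bracket (Suc d) = y - theta"
      by (simp_all add: bracket_def x_def y_def)
    have yq: "(y - theta) ^ ?q = w - x"
      by (simp add: fls_frobenius_diff x_def y_def w_def mult.commute flip: power_mult)
    have nz: "x \<noteq> theta" "y \<noteq> theta" "L \<noteq> 0"
      using bracket_nonzero[of "Suc 0", where 'a = 'a] bracket_nonzero[of "Suc d", where 'a = 'a]
      unfolding B by (auto simp: L_def)
    then have "w \<noteq> x" using yq by auto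
    have "coeff (carlitz_poly (Suc d)) m =
        inverse (y - theta) * (inverse L - (x - y) / ((x - theta) * L))"
      using c Suc.IH[of 1] Suc.IH[of ?q] lt[of 1] lt[of ?q] q 2
      by (simp add: B power_inverse x_def y_def L_def del: carlitz_poly.simps)
    also have "inverse L - (x - y) / ((x - theta) * L) = (y - theta) / ((x - theta) * L)"
      using nz by (simp add: divide_simps)
    also have "inverse (y - theta) * \<dots> = (x - w) / ((x - theta) * (- (w - x) * L))"
      using nz \<open>w \<noteq> x\<close> by (simp add: divide_simps)
    also have "- (w - x) * L = carlitz_l (Suc d) ^ ?q"
      by (simp only: carlitz_l_Suc power_mult_distrib fls_frobenius_uminus B yq L_def)
    finally show ?thesis using 2 q by (simp add: B x_def w_def)
  next
    case 3
    have "coeff (carlitz_poly d) (m div ?q) = (0 :: 'a fls)" if dvd: "?q dvd m"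
    proof -
      obtain k where k: "m = ?q * k" using dvd by blast
      have "k < ?q" using Suc.prems k by (simp add: power2_eq_square)
      moreover have "k \<noteq> 1" using 3 k by auto
      ultimately show ?thesis using Suc.IH[of k] lt[of k] k by simp
    qed
    then show ?thesis
      using c Suc.IH[of m] Suc.prems 3 by (simp add: power_0_left del: carlitz_poly.simps)
  qed
qed

subsection \<open>Power sums\<close>

lemma A_plus_degree_eq:
  "{a. a \<in> A_plus \<and> degree a = d} = (\<lambda>xs. Poly (xs @ [1 :: 'a::field])) ` {xs. length xs = d}"
proof -
  have *: "coeffs (Poly (xs @ [1 :: 'a])) = xs @ [1]" for xs
    by (simp add: coeffs_Poly)
  show ?thesis
  proof (intro equalityI subsetI)
    fix a :: "'a poly" assume a: "a \<in> {a. a \<in> A_plus \<and> degree a = d}"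
    then have nz: "a \<noteq> 0" by (auto simp: A_plus_def)
    then have "last (coeffs a) = 1"
      using a last_coeffs_eq_coeff_degree[OF nz] by (auto simp: A_plus_def)
    then have "coeffs a = butlast (coeffs a) @ [1]"
      using nz by (metis append_butlast_last_id coeffs_eq_Nil)
    then have "a = Poly (butlast (coeffs a) @ [1])" by (metis Poly_coeffs)
    moreover have "length (butlast (coeffs a)) = d"
      using a nz by (simp add: length_coeffs_degree)
    ultimately show "a \<in> (\<lambda>xs. Poly (xs @ [1])) ` {xs. length xs = d}" by blast
  next
    fix a assume "a \<in> (\<lambda>xs. Poly (xs @ [1 :: 'a])) ` {xs. length xs = d}"
    then obtain xs where xs: "a = Poly (xs @ [1])" "length xs = d" by blast
    then have c: "coeffs a = xs @ [1]" by (simp only: *)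
    then have "a \<noteq> 0" by auto
    then show "a \<in> {a. a \<in> A_plus \<and> degree a = d}"
      using c xs(2) last_coeffs_eq_coeff_degree[of a] length_coeffs_degree[of a]
      by (simp add: A_plus_def)
  qed
qed

text \<open>The count equals the degree of \<open>carlitz_poly d\<close>, so these polynomials can
  exhaust the zeros of \<open>carlitz_poly d - 1\<close>.\<close>

lemma card_A_plus_degree:
  "card {a. a \<in> (A_plus :: 'a::{field,finite} poly set) \<and> degree a = d} = CARD('a) ^ d"
proof -
  have "inj (\<lambda>xs. Poly (xs @ [1 :: 'a]))"
  proof (rule injI)
    fix xs ys assume "Poly (xs @ [1 :: 'a]) = Poly (ys @ [1])"
    then have "coeffs (Poly (xs @ [1 :: 'a])) = coeffs (Poly (ys @ [1]))" by simp
    then show "xs = ys" by (simp add: coeffs_Poly)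
  qed
  then show ?thesis
    using card_lists_length_eq[of "UNIV :: 'a set" d]
    by (simp add: A_plus_degree_eq card_image inj_on_subset)
qed

lemma finite_A_plus_degree_eq [simp]:
  "finite {a. a \<in> (A_plus :: 'a::{field,finite} poly set) \<and> degree a = d}"
  by (rule card_ge_0_finite) (simp add: card_A_plus_degree)

section \<open>Generating function of the power sums\<close>

text \<open>Both sides have degree at most \<open>q ^ d\<close>, share the coefficient there, and
  vanish at the \<open>q ^ d\<close> monic polynomials of degree d.\<close>

lemma carlitz_poly_minus_1_eq_prod:
  "carlitz_poly d - 1 =
     smult (coeff (carlitz_poly d) (CARD('a) ^ d))
       (\<Prod>a | a \<in> A_plus \<and> degree a = d. [:- of_A (a :: 'a::{field,finite} poly), 1:])"
  (is "_ = smult ?c (prod ?f ?M)")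
proof (rule poly_eqI_degree_lead_coeff[where A = "of_A ` ?M" and n = "CARD('a) ^ d"])
  have "degree (prod ?f ?M) = CARD('a) ^ d"
    by (simp add: degree_prod_eq_sum_degree card_A_plus_degree)
  moreover have "lead_coeff (prod ?f ?M) = 1"
    by (simp only: lead_coeff_prod) simp
  ultimately show "coeff (carlitz_poly d - 1) (CARD('a) ^ d) =
      coeff (smult ?c (prod ?f ?M)) (CARD('a) ^ d)"
    and "degree (smult ?c (prod ?f ?M)) \<le> CARD('a) ^ d"
    by (simp_all add: order_trans[OF degree_smult_le])
  show "CARD('a) ^ d \<le> card (of_A ` ?M)"
    by (simp add: card_image inj_on_subset[OF of_A_inj] card_A_plus_degree)
  show "degree (carlitz_poly d - 1 :: 'a fls poly) \<le> CARD('a) ^ d"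
    by (intro degree_diff_le) (simp_all add: degree_carlitz)
  fix z assume "z \<in> of_A ` ?M"
  then obtain a where a: "z = of_A a" "a \<in> ?M" by blast
  then have "poly (prod ?f ?M) z = 0"
    by (auto simp: poly_prod intro!: prod_zero bexI[of _ a])
  moreover have "poly (carlitz_poly d) z = 1"
    using a poly_carlitz_of_A[of a d] by (auto simp: A_plus_def)
  ultimately show "poly (carlitz_poly d - 1) z = poly (smult ?c (prod ?f ?M)) z" by simp
qed

text \<open>The geometric series \<open>h a\<close> is minus the inverse of \<open>z - g a\<close>,
  so the series of power sums is minus the logarithmic derivative of the product; multiplying by the
  product avoids dividing power series.\<close>

lemma fps_prod_linear_times_power_sums:
  fixes g :: "'i \<Rightarrow> 'b::field"
  assumes "finite M" and nz: "\<And>a. a \<in> M \<Longrightarrow> g a \<noteq> 0"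
  shows "fps_of_poly (\<Prod>a\<in>M. [:- g a, 1:]) * Abs_fps (\<lambda>k. \<Sum>a\<in>M. inverse (g a) ^ Suc k) =
    - fps_of_poly (pderiv (\<Prod>a\<in>M. [:- g a, 1:]))"
proof -
  define h where "h a = Abs_fps (\<lambda>k. inverse (g a) ^ Suc k)" for a
  have inv: "fps_of_poly [:- g a, 1:] * h a = - 1" if "a \<in> M" for a
  proof (rule fps_ext)
    fix k
    show "fps_nth (fps_of_poly [:- g a, 1:] * h a) k = fps_nth (- 1) k"
      using nz[OF that]
      by (cases k) (auto simp: fps_of_poly_linear h_def distrib_right
        simp del: fps_const_neg)
  qed
  have "Abs_fps (\<lambda>k. \<Sum>a\<in>M. inverse (g a) ^ Suc k) = (\<Sum>a\<in>M. h a)"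
    by (rule fps_ext) (simp add: fps_sum_nth h_def)
  then have "fps_of_poly (\<Prod>a\<in>M. [:- g a, 1:]) * Abs_fps (\<lambda>k. \<Sum>a\<in>M. inverse (g a) ^ Suc k) =
      (\<Sum>a\<in>M. fps_of_poly (\<Prod>b\<in>M. [:- g b, 1:]) * h a)"
    by (simp add: sum_distrib_left)
  also have "\<dots> = (\<Sum>a\<in>M. - fps_of_poly (\<Prod>b\<in>M - {a}. [:- g b, 1:]))"
  proof (rule sum.cong[OF refl])
    fix a assume a: "a \<in> M"
    have "fps_of_poly (\<Prod>b\<in>M. [:- g b, 1:]) * h a =
        fps_of_poly (\<Prod>b\<in>M - {a}. [:- g b, 1:]) * (fps_of_poly [:- g a, 1:] * h a)"
      using prod.remove[OF assms(1) a, of "\<lambda>b. [:- g b, 1:]"]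
      by (simp only: fps_of_poly_mult mult_ac)
    then show "fps_of_poly (\<Prod>b\<in>M. [:- g b, 1:]) * h a =
        - fps_of_poly (\<Prod>b\<in>M - {a}. [:- g b, 1:])"
      using inv[OF a] by simp
  qed
  also have "\<dots> = - fps_of_poly (pderiv (\<Prod>a\<in>M. [:- g a, 1:]))"
    by (simp add: pderiv_prod pderiv_pCons fps_of_poly_sum sum_negf)
  finally show ?thesis .
qed

lemma power_sum_altdef:
  "power_sum d (int k) = (\<Sum>a | a \<in> A_plus \<and> degree a = d. inverse (of_A a) ^ k)"
  by (simp add: power_sum_def power_int_minus power_inverse)

lemma power_sum_frobenius:
  "power_sum d (int (k * CARD('a) ^ j)) =
     (power_sum d (int k) :: 'a::{field,finite} fls) ^ (CARD('a) ^ j)"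
  by (simp only: power_sum_altdef fls_frobenius_power_sum power_mult)

text \<open>The numerator of the logarithmic derivative is constant, because the derivative of
  \<open>carlitz_poly d\<close> is.\<close>

lemma carlitz_power_sum_generating_function:
  "fps_of_poly (carlitz_poly d - 1) * Abs_fps (\<lambda>k. power_sum d (int (Suc k))) =
     - fps_const (inverse (carlitz_l d :: 'a::{field,finite} fls))"
proof -
  let ?M = "{a. a \<in> (A_plus :: 'a poly set) \<and> degree a = d}"
  let ?P = "\<Prod>a\<in>?M. [:- of_A a, 1:]"
  let ?c = "coeff (carlitz_poly d) (CARD('a) ^ d) :: 'a fls"
  have eq: "carlitz_poly d - 1 = smult ?c ?P" by (rule carlitz_poly_minus_1_eq_prod)
  have "fps_of_poly ?P * Abs_fps (\<lambda>k. power_sum d (int (Suc k))) = - fps_of_poly (pderiv ?P)"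
    unfolding power_sum_altdef
    by (rule fps_prod_linear_times_power_sums[OF finite_A_plus_degree_eq]) (auto simp: A_plus_def)
  then have "fps_of_poly (smult ?c ?P) * Abs_fps (\<lambda>k. power_sum d (int (Suc k))) =
      - fps_of_poly (smult ?c (pderiv ?P))"
    by (simp only: fps_of_poly_smult mult.assoc mult_minus_right)
  also have "smult ?c (pderiv ?P) = pderiv (carlitz_poly d - 1)"
    by (simp only: eq pderiv_smult)
  also have "\<dots> = [:inverse (carlitz_l d):]"
    by (simp add: pderiv_diff pderiv_carlitz)
  finally show ?thesis by (simp only: eq fps_of_poly_const)
qed

text \<open>Compares coefficients of degree \<open>N\<close> in the generating function identity;
  its constant right-hand side is invisible for positive \<open>N\<close>.\<close>

lemma power_sum_recurrence:
  assumes "N > 0"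
  shows "power_sum d (int (Suc N)) =
    (\<Sum>i=1..N. coeff (carlitz_poly d) i * (power_sum d (int (Suc N - i)) :: 'a::{field,finite} fls))"
proof -
  let ?F = "Abs_fps (\<lambda>k. power_sum d (int (Suc k))) :: 'a fls fps"
  have "fps_of_poly (carlitz_poly d - 1) * ?F = fps_of_poly (carlitz_poly d) * ?F - ?F"
    by (simp add: fps_of_poly_diff algebra_simps)
  then have "fps_of_poly (carlitz_poly d) * ?F - ?F = - fps_const (inverse (carlitz_l d))"
    by (simp only: carlitz_power_sum_generating_function)
  from arg_cong[OF this, of "\<lambda>f. fps_nth f N"]
  have "fps_nth (fps_of_poly (carlitz_poly d) * ?F) N = power_sum d (int (Suc N))"
    using assms by simp
  then show ?thesis
    by (simp add: fps_mult_nth sum.atLeast_Suc_atMost[of 0] coeff_carlitz_0 Suc_diff_le)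
qed

section \<open>Closed forms of the power sums\<close>

lemma power_sum_1: "power_sum d 1 = inverse (carlitz_l d)"
  using arg_cong[OF carlitz_power_sum_generating_function[of d], of "\<lambda>f. fps_nth f 0"]
  by (simp add: coeff_carlitz_0)

text \<open>For \<open>N = q - 1\<close> only i = 1 contributes, so S_d(q) = S_d(q-1)/l_d, while
  Frobenius gives S_d(q) = S_d(1)^q.\<close>

lemma power_sum_card_minus_1:
  "power_sum d (int (CARD('a) - 1)) = inverse (carlitz_l d :: 'a::{field,finite} fls) ^ (CARD('a) - 1)"
proof -
  let ?q = "CARD('a)"
  have q: "?q \<ge> 2" by (rule card_field_ge_2)
  have lt: "?q \<le> ?q\<^sup>2" by (simp add: power2_nat_le_imp_le)
  have "power_sum d (int ?q) =
      (\<Sum>i=1..?q - 1. coeff (carlitz_poly d) i * (power_sum d (int (?q - i)) :: 'a fls))"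
    using power_sum_recurrence[of "?q - 1" d, where 'a = 'a] q by simp
  also have "\<dots> = (\<Sum>i\<in>{1}. coeff (carlitz_poly d) i * power_sum d (int (?q - i)))"
    using q lt by (intro sum.mono_neutral_right) (auto simp: coeff_carlitz)
  also have "\<dots> = inverse (carlitz_l d) * power_sum d (int (?q - 1))"
    using q lt by (simp add: coeff_carlitz)
  finally have "inverse (carlitz_l d) * power_sum d (int (?q - 1)) =
      inverse (carlitz_l d :: 'a fls) ^ ?q"
    using power_sum_frobenius[of d 1 1, where 'a = 'a] by (simp add: power_sum_1)
  also have "\<dots> = inverse (carlitz_l d) * inverse (carlitz_l d) ^ (?q - 1)"
    using q by (metis Suc_diff_1 power_Suc zero_less_card_finite)
  finally show ?thesis by (simp only: mult_cancel_left) simp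
qed

text \<open>For \<open>N = q^2 - 1\<close> only i = 1 and i = q contribute. Frobenius supplies
  S_d(q^2) = S_d(1)^(q^2) and S_d(q^2-q) = S_d(q-1)^q, and the relation is solved for
  S_d(q^2-1).\<close>

lemma power_sum_card_sq_minus_1:
  "power_sum d (int (CARD('a)\<^sup>2 - 1)) =
     carlitz_l (Suc d) / (carlitz_l 1 * (carlitz_l d :: 'a::{field,finite} fls) ^ CARD('a)\<^sup>2)"
proof -
  let ?q = "CARD('a)"
  define l x y :: "'a fls" where "l = carlitz_l d" and "x = theta ^ ?q"
    and "y = theta ^ (?q ^ Suc d)"
  define S where "S k = (power_sum d (int k) :: 'a fls)" for k
  have q: "?q \<ge> 2" by (rule card_field_ge_2)
  have lt: "?q < ?q\<^sup>2" using q by (simp add: power2_eq_square)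
  have nz: "l \<noteq> 0" "x - theta \<noteq> 0"
    using bracket_nonzero[of 1, where 'a = 'a] by (simp_all add: l_def x_def bracket_def)
  have E: "coeff (carlitz_poly d) ?q = (x - y) / ((x - theta) * l ^ ?q)"
    using q lt by (simp add: coeff_carlitz x_def y_def l_def bracket_def)
  have "S (?q\<^sup>2) = (\<Sum>i=1..?q\<^sup>2 - 1. coeff (carlitz_poly d) i * S (?q\<^sup>2 - i))"
    using power_sum_recurrence[of "?q\<^sup>2 - 1" d, where 'a = 'a] q lt by (simp add: S_def)
  also have "\<dots> = (\<Sum>i\<in>{1, ?q}. coeff (carlitz_poly d) i * S (?q\<^sup>2 - i))"
    using q lt by (intro sum.mono_neutral_right) (auto simp: coeff_carlitz)
  also have "\<dots> = inverse l * S (?q\<^sup>2 - 1) + (x - y) / ((x - theta) * l ^ ?q) * S (?q\<^sup>2 - ?q)"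
    using q lt E by (simp add: coeff_carlitz l_def)
  also have "S (?q\<^sup>2) = inverse l ^ ?q\<^sup>2"
    using power_sum_frobenius[of d 1 2, where 'a = 'a] by (simp add: S_def power_sum_1 l_def)
  also have "?q\<^sup>2 - ?q = (?q - 1) * ?q ^ 1" by (simp add: power2_eq_square algebra_simps)
  also have "S \<dots> = inverse l ^ ((?q - 1) * ?q)"
    unfolding S_def power_sum_frobenius power_sum_card_minus_1 l_def by (simp add: power_mult)
  also have "\<dots> = l ^ ?q * inverse l ^ ?q\<^sup>2"
  proof -
    have "?q\<^sup>2 = ?q + (?q - 1) * ?q" using q by (simp add: power2_eq_square algebra_simps)
    then have "inverse l ^ ?q\<^sup>2 = inverse l ^ ?q * inverse l ^ ((?q - 1) * ?q)"
      by (simp only: power_add)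
    then show ?thesis using nz by (simp add: power_inverse)
  qed
  finally have "inverse l ^ ?q\<^sup>2 = inverse l * S (?q\<^sup>2 - 1)
      + (x - y) / ((x - theta) * l ^ ?q) * (l ^ ?q * inverse l ^ ?q\<^sup>2)" .
  moreover have "(x - y) / ((x - theta) * l ^ ?q) * (l ^ ?q * inverse l ^ ?q\<^sup>2) =
      (x - y) / (x - theta) * inverse l ^ ?q\<^sup>2"
    using nz by simp
  ultimately have "inverse l * S (?q\<^sup>2 - 1) = inverse l ^ ?q\<^sup>2 * (1 - (x - y) / (x - theta))"
    by (simp add: algebra_simps)
  then have "l * (inverse l * S (?q\<^sup>2 - 1)) =
      l * (inverse l ^ ?q\<^sup>2 * (1 - (x - y) / (x - theta)))"
    by (rule arg_cong)
  then have "S (?q\<^sup>2 - 1) = l * inverse l ^ ?q\<^sup>2 * (1 - (x - y) / (x - theta))"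
    using nz by (simp add: mult.assoc[symmetric])
  \<comment> \<open>The bracketed factor is \<open>(y - theta) / (x - theta)\<close>; both signs are
    flipped so that \<open>carlitz_l (Suc d)\<close> and \<open>carlitz_l 1\<close> appear.\<close>
  also have "\<dots> = - (y - theta) * l / (- (x - theta) * l ^ ?q\<^sup>2)"
    using nz by (simp add: field_simps)
  also have "\<dots> = carlitz_l (Suc d) / (carlitz_l 1 * l ^ ?q\<^sup>2)"
    using carlitz_l_Suc[of 0, where 'a = 'a]
    by (simp add: carlitz_l_Suc l_def x_def y_def bracket_def)
  finally show ?thesis by (simp add: S_def l_def)
qed

subsection \<open>Limits of formal Laurent series\<close>

lemma dist_fls_le_iff:
  fixes x y :: "'b::ab_group_add fls"
  shows "dist x y \<le> inverse (2 ^ n) \<longleftrightarrow> (\<forall>k<int n. fls_nth x k = fls_nth y k)"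
proof (cases "x = y")
  case False
  let ?s = "fls_subdegree (x - y)"
  show ?thesis
  proof
    assume *: "dist x y \<le> inverse (2 ^ n)"
    have s: "?s \<ge> 0"
    proof (rule ccontr)
      assume "\<not> ?s \<ge> 0"
      then have "dist x y > 1" using False by (simp add: dist_fls_def)
      moreover have "inverse (2 ^ n) \<le> (1 :: real)" by (simp add: inverse_le_1_iff)
      ultimately show False using * by linarith
    qed
    then have "inverse (2 ^ nat ?s) \<le> inverse (2 ^ n :: real)"
      using * False by (simp add: dist_fls_def)
    then have "n \<le> nat ?s" by simp
    then have "fls_nth (x - y) k = 0" if "k < int n" for k
      using that s by (intro fls_eq0_below_subdegree) linarith
    then show "\<forall>k<int n. fls_nth x k = fls_nth y k" by simp
  next
    assume "\<forall>k<int n. fls_nth x k = fls_nth y k"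
    then have "?s \<ge> int n" using False by (intro fls_subdegree_geI) auto
    then show "dist x y \<le> inverse (2 ^ n)"
      using False by (auto simp: dist_fls_def intro!: power_increasing)
  qed
qed simp

text \<open>Convergence is read off from coefficients up to each order; the limit laws below are
  proved in this form.\<close>

lemma tendsto_fls_iff:
  fixes f :: "'i \<Rightarrow> 'b::ab_group_add fls"
  shows "(f \<longlongrightarrow> L) F \<longleftrightarrow> (\<forall>n. \<forall>\<^sub>F x in F. \<forall>k<int n. fls_nth (f x) k = fls_nth L k)"
proof
  assume lim: "(f \<longlongrightarrow> L) F"
  show "\<forall>n. \<forall>\<^sub>F x in F. \<forall>k<int n. fls_nth (f x) k = fls_nth L k"
  proof
    fix n
    have "\<forall>\<^sub>F x in F. dist (f x) L < inverse (2 ^ n)"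
      by (rule tendstoD[OF lim]) simp
    then show "\<forall>\<^sub>F x in F. \<forall>k<int n. fls_nth (f x) k = fls_nth L k"
      by eventually_elim (metis dist_fls_le_iff less_imp_le)
  qed
next
  assume *: "\<forall>n. \<forall>\<^sub>F x in F. \<forall>k<int n. fls_nth (f x) k = fls_nth L k"
  show "(f \<longlongrightarrow> L) F"
  proof (rule tendstoI)
    fix e :: real assume "e > 0"
    then obtain n :: nat where n: "inverse (2 ^ n) < e"
      using real_arch_pow_inv[of e "1/2"] by (auto simp: power_one_over inverse_eq_divide)
    from *[rule_format, of n] show "\<forall>\<^sub>F x in F. dist (f x) L < e"
    proof eventually_elim
      case (elim x)
      then have "dist (f x) L \<le> inverse (2 ^ n)" by (simp only: dist_fls_le_iff)
      then show ?case using n by linarith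
    qed
  qed
qed

lemma tendsto_fls_diff:
  fixes f g :: "'i \<Rightarrow> 'b::ab_group_add fls"
  assumes "(f \<longlongrightarrow> L) F" "(g \<longlongrightarrow> M) F"
  shows "((\<lambda>x. f x - g x) \<longlongrightarrow> L - M) F"
  unfolding tendsto_fls_iff
proof
  fix n
  show "\<forall>\<^sub>F x in F. \<forall>k<int n. fls_nth (f x - g x) k = fls_nth (L - M) k"
    using assms[unfolded tendsto_fls_iff, rule_format, of n]
    by eventually_elim simp
qed

lemma tendsto_fls_mult_left:
  fixes f :: "'i \<Rightarrow> 'b::comm_ring_1 fls"
  assumes "(f \<longlongrightarrow> L) F"
  shows "((\<lambda>x. c * f x) \<longlongrightarrow> c * L) F"
  unfolding tendsto_fls_iff
proof
  fix n
  \<comment> \<open>Multiplication by \<open>c\<close> shifts orders by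
    \<open>fls_subdegree c\<close>, so agreement below \<open>m\<close> yields agreement of the
    products below \<open>n\<close>.\<close>
  define m where "m = nat (int n - fls_subdegree c)"
  show "\<forall>\<^sub>F x in F. \<forall>k<int n. fls_nth (c * f x) k = fls_nth (c * L) k"
    using assms[unfolded tendsto_fls_iff, rule_format, of m]
  proof eventually_elim
    case (elim x)
    have "fls_nth (c * (f x - L)) k = 0" if "k < int n" for k
    proof (cases "f x = L")
      case False
      then have "fls_subdegree (f x - L) \<ge> int m"
        using elim by (intro fls_subdegree_geI) auto
      then show ?thesis using that unfolding m_def by (intro fls_times_nth_eq0) linarith
    qed simp
    then show ?case by (simp add: right_diff_distrib)
  qed
qed

text \<open>Every finite subset of \<open>A\<close> is eventually contained in \<open>X n\<close>,
  so an unordered sum may be computed along any increasing exhaustion by finite sets.\<close>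

lemma infsum_sequential_limit:
  fixes f :: "'i \<Rightarrow> 'b::{comm_monoid_add,t2_space}"
  assumes "f summable_on A" and "\<And>n. finite (X n)" and "\<And>n. X n \<subseteq> A" and "mono X"
    and "A \<subseteq> (\<Union>n. X n)"
  shows "(\<lambda>n. sum f (X n)) \<longlonglongrightarrow> infsum f A"
proof -
  have "filterlim X (finite_subsets_at_top A) sequentially"
    unfolding filterlim_finite_subsets_at_top
  proof (intro allI impI)
    fix Y assume Y: "finite Y \<and> Y \<subseteq> A"
    then have "finite Y" "Y \<subseteq> A" by auto
    then have "\<forall>\<^sub>F n in sequentially. Y \<subseteq> X n"
    proof (induction Y rule: finite_induct)
      case (insert y Y)
      then obtain n where "y \<in> X n" using assms(5) by auto
      then have "\<forall>\<^sub>F n in sequentially. y \<in> X n"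
        using monoD[OF assms(4)] unfolding eventually_sequentially by blast
      moreover have "\<forall>\<^sub>F n in sequentially. Y \<subseteq> X n" using insert by simp
      ultimately show ?case by eventually_elim simp
    qed simp
    then show "\<forall>\<^sub>F n in sequentially. finite (X n) \<and> Y \<subseteq> X n \<and> X n \<subseteq> A"
      by eventually_elim (use assms in auto)
  qed
  moreover have "(sum f \<longlongrightarrow> infsum f A) (finite_subsets_at_top A)"
    using has_sum_infsum[OF assms(1)] by (simp add: has_sum_def)
  ultimately show ?thesis
    by (rule filterlim_compose[rotated])
qed

subsection \<open>Truncated multizeta values\<close>

lemma zeta_partial_sums_tendsto:
  assumes "k > 0"
  shows "(\<lambda>D. \<Sum>d<D. power_sum d (int k)) \<longlonglongrightarrow> (zeta k :: 'a::{field,finite} fls)"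
proof -
  let ?f = "\<lambda>a. of_A a powi (- int k) :: 'a fls"
  let ?X = "\<lambda>D. {a \<in> (A_plus :: 'a poly set). degree a < D}"
  have "(\<lambda>D. sum ?f (?X D)) \<longlonglongrightarrow> infsum ?f A_plus"
    by (rule infsum_sequential_limit[OF zeta_summable[OF assms]])
       (auto simp: finite_A_plus_degree monotone_def)
  moreover have "sum ?f (?X D) = (\<Sum>d<D. power_sum d (int k))" for D
  proof -
    have "sum ?f (?X D) = (\<Sum>d<D. sum ?f {a \<in> ?X D. degree a = d})"
      by (rule sum.group[symmetric]) (auto simp: finite_A_plus_degree)
    also have "\<dots> = (\<Sum>d<D. power_sum d (int k))"
      unfolding power_sum_def by (intro sum.cong) auto
    finally show ?thesis .
  qed
  ultimately show ?thesis by (simp add: zeta_def)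
qed

definition bounded_tuples :: "nat \<Rightarrow> nat \<Rightarrow> nat list set" where
  "bounded_tuples r D = {ds \<in> decreasing_tuples r. set ds \<subseteq> {..<D}}"

text \<open>Usually written S_{<D}(s). The strict bound makes the inner sum below a leading index d
  again a truncated value, at d.\<close>

definition truncated_multizeta :: "nat list \<Rightarrow> nat \<Rightarrow> 'a::{field,finite} fls" where
  "truncated_multizeta s D =
     (\<Sum>ds\<in>bounded_tuples (length s) D. \<Prod>i<length s. power_sum (ds ! i) (int (s ! i)))"

lemma finite_bounded_tuples: "finite (bounded_tuples r D)"
proof (rule finite_subset)
  show "bounded_tuples r D \<subseteq> {ds. set ds \<subseteq> {..<D} \<and> length ds = r}"
    by (auto simp: bounded_tuples_def decreasing_tuples_def)
qed (simp add: finite_lists_length_eq)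

lemma truncated_multizeta_tendsto:
  assumes "\<forall>x\<in>set s. x > 0"
  shows "truncated_multizeta s \<longlonglongrightarrow> (multizeta s :: 'a::{field,finite} fls)"
  unfolding multizeta_def truncated_multizeta_def
proof (rule infsum_sequential_limit[OF multizeta_summable[OF assms]])
  show "mono (bounded_tuples (length s))"
    by (rule monoI) (auto simp: bounded_tuples_def)
  show "decreasing_tuples (length s) \<subseteq> (\<Union>D. bounded_tuples (length s) D)"
  proof
    fix ds assume "ds \<in> decreasing_tuples (length s)"
    \<comment> \<open>For the empty tuple any value of \<open>Max\<close> will do, since the bound
      on its entries is vacuous.\<close>
    then have "ds \<in> bounded_tuples (length s) (Suc (Max (set ds)))"
      by (auto simp: bounded_tuples_def less_Suc_eq_le)
    then show "ds \<in> (\<Union>D. bounded_tuples (length s) D)" by blast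
  qed
  show "bounded_tuples (length s) D \<subseteq> decreasing_tuples (length s)" for D
    by (auto simp: bounded_tuples_def)
qed (rule finite_bounded_tuples)

lemma truncated_multizeta_Nil: "truncated_multizeta [] D = 1"
proof -
  have "bounded_tuples 0 D = {[]}" by (auto simp: bounded_tuples_def decreasing_tuples_def)
  then show ?thesis by (simp add: truncated_multizeta_def)
qed

text \<open>Sorts the tuples by their largest index \<open>d\<close>; the remaining indices form a
  decreasing tuple below \<open>d\<close>.\<close>

lemma truncated_multizeta_Cons:
  "truncated_multizeta (x # s) D =
     (\<Sum>d<D. power_sum d (int x) * (truncated_multizeta s d :: 'a::{field,finite} fls))"
proof -
  let ?g = "\<lambda>ds. \<Prod>i<length s. power_sum (ds ! i) (int (s ! i)) :: 'a fls"
  have "(\<Sum>d<D. power_sum d (int x) * truncated_multizeta s d) =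
      (\<Sum>(d, ds)\<in>(SIGMA d:{..<D}. bounded_tuples (length s) d). power_sum d (int x) * ?g ds)"
    by (simp add: truncated_multizeta_def sum_distrib_left sum.Sigma finite_bounded_tuples)
  also have "\<dots> = truncated_multizeta (x # s) D"
    unfolding truncated_multizeta_def
  proof (rule sum.reindex_bij_witness[where i = "\<lambda>l. (hd l, tl l)" and j = "\<lambda>(d, ds). d # ds"])
    fix l assume "l \<in> bounded_tuples (length (x # s)) D"
    then obtain d ds where l: "l = d # ds" and b: "d # ds \<in> bounded_tuples (Suc (length s)) D"
      by (cases l) (auto simp: bounded_tuples_def decreasing_tuples_def)
    show "(case (hd l, tl l) of (d, ds) \<Rightarrow> d # ds) = l" using l by simp
    show "(hd l, tl l) \<in> (SIGMA d:{..<D}. bounded_tuples (length s) d)"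
      using b l by (auto simp: bounded_tuples_def decreasing_tuples_def)
  next
    fix p assume "p \<in> (SIGMA d:{..<D}. bounded_tuples (length s) d)"
    then obtain d ds where p: "p = (d, ds)" "d < D" "ds \<in> bounded_tuples (length s) d" by auto
    show "(hd (case p of (d, ds) \<Rightarrow> d # ds), tl (case p of (d, ds) \<Rightarrow> d # ds)) = p"
      using p by simp
    show "(case p of (d, ds) \<Rightarrow> d # ds) \<in> bounded_tuples (length (x # s)) D"
      using p by (auto simp: bounded_tuples_def decreasing_tuples_def subset_iff
          intro: less_trans)
    show "(\<Prod>i<length (x # s). power_sum ((case p of (d, ds) \<Rightarrow> d # ds) ! i) (int ((x # s) ! i)))
        = (case p of (d, ds) \<Rightarrow> power_sum d (int x) * ?g ds)"
      by (simp add: p(1) prod.lessThan_Suc_shift del: prod.lessThan_Suc)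
  qed
  finally show ?thesis by (rule sym)
qed

subsection \<open>Telescoping sums\<close>

lemma bracket_frobenius_power:
  "bracket k ^ (CARD('a) ^ j) = bracket (k + j) - (bracket j :: 'a::{field,finite} fls)"
  by (simp add: bracket_def fls_frobenius_power_diff power_add flip: power_mult)

text \<open>For \<open>d < m\<close> the value \<open>0\<close> plays the role of \<open>1 / carlitz_l (d - m)\<close>.\<close>

definition carlitz_ratio :: "nat \<Rightarrow> nat \<Rightarrow> 'a::{field,finite} fls" where
  "carlitz_ratio m d =
     (if m \<le> d then carlitz_l d / carlitz_l (d - m) ^ (CARD('a) ^ m) else 0)"

lemma carlitz_l_Suc_frobenius:
  "carlitz_l (Suc k) ^ (CARD('a) ^ m) =
     (bracket m - bracket (Suc k + m)) * (carlitz_l k :: 'a::{field,finite} fls) ^ (CARD('a) ^ m)"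
proof -
  have "carlitz_l (Suc k) ^ (CARD('a) ^ m) =
      - (bracket (Suc k) ^ (CARD('a) ^ m)) * (carlitz_l k :: 'a fls) ^ (CARD('a) ^ m)"
    by (simp only: carlitz_l_Suc power_mult_distrib fls_frobenius_power_uminus)
  then show ?thesis by (simp only: bracket_frobenius_power minus_diff_eq)
qed

text \<open>For d = m + k + 1, \<open>carlitz_l_Suc_frobenius\<close> gives a common denominator,
  and the numerators combine as -[d+1] - ([m+1] - [d+1]) = -[m+1]. At d = m the default 0 of the
  ratio makes the formula persist.\<close>

lemma carlitz_ratio_diff:
  "carlitz_ratio (Suc m) (Suc d) - carlitz_ratio (Suc m) d =
     - bracket (Suc m) *
     (if m \<le> d then carlitz_l d / (carlitz_l (d - m) :: 'a::{field,finite} fls) ^ (CARD('a) ^ Suc m) else 0)"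
proof -
  consider "d < m" | "d = m" | k where "d = m + Suc k"
    by (metis less_imp_Suc_add linorder_neqE_nat add_Suc_right)
  then show ?thesis
  proof cases
    case 1
    then show ?thesis by (simp add: carlitz_ratio_def)
  next
    case 2
    then show ?thesis by (simp add: carlitz_ratio_def carlitz_l_Suc)
  next
    case 3
    let ?Q = "CARD('a) ^ Suc m"
    define P where "P = (carlitz_l k :: 'a fls) ^ ?Q"
    define l where "l = (carlitz_l d :: 'a fls)"
    define b c :: "'a fls" where "b = bracket (Suc d)" and "c = bracket (Suc m)"
    have L: "carlitz_l (Suc k) ^ ?Q = (c - b) * P"
      unfolding carlitz_l_Suc_frobenius[of k "Suc m"] by (simp add: b_def c_def P_def 3 add.commute)
    have "(c - b) * P \<noteq> 0" unfolding L[symmetric] by simp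
    then have nz: "c - b \<noteq> 0" "P \<noteq> 0" by auto
    have "carlitz_ratio (Suc m) (Suc d) - carlitz_ratio (Suc m) d =
        carlitz_l (Suc d) / carlitz_l (Suc k) ^ ?Q - l / P"
      using 3 by (simp add: carlitz_ratio_def l_def P_def)
    also have "\<dots> = - b * l / ((c - b) * P) - l / P"
      by (simp only: L) (simp add: carlitz_l_Suc b_def l_def)
    also have "\<dots> = - c * (l / ((c - b) * P))"
      using nz by (simp add: divide_simps) (simp add: algebra_simps)
    also have "\<dots> = - c * (if m \<le> d then l / carlitz_l (d - m) ^ ?Q else 0)"
      using 3 by (simp only: L[symmetric]) simp
    finally show ?thesis by (simp only: c_def l_def)
  qed
qed

text \<open>Telescopes by \<open>carlitz_ratio_diff\<close>, starting from the default
  \<open>carlitz_ratio (Suc m) 0 = 0\<close>.\<close>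

lemma carlitz_ratio_sum:
  "(\<Sum>e<d. if m \<le> e then carlitz_l e / carlitz_l (e - m) ^ (CARD('a) ^ Suc m) else 0) =
     - (carlitz_ratio (Suc m) d / (bracket (Suc m) :: 'a::{field,finite} fls))"
proof -
  let ?t = "\<lambda>e. if m \<le> e then carlitz_l e / carlitz_l (e - m) ^ (CARD('a) ^ Suc m) else 0 :: 'a fls"
  have "(- bracket (Suc m)) * (\<Sum>e<d. ?t e) = (carlitz_ratio (Suc m) d :: 'a fls)"
  proof (induction d)
    case 0
    then show ?case by (simp add: carlitz_ratio_def)
  next
    case (Suc d)
    have "- bracket (Suc m) * (\<Sum>e<Suc d. ?t e) =
      - bracket (Suc m) * (\<Sum>e<d. ?t e) + - bracket (Suc m) * ?t d"
      by (simp only: sum.lessThan_Suc distrib_left)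
    also have "\<dots> = carlitz_ratio (Suc m) (Suc d)"
      unfolding Suc carlitz_ratio_diff[symmetric] by simp
    finally show ?case .
  qed
  from this[symmetric] show ?thesis
    using bracket_nonzero[of "Suc m", where 'a = 'a] by simp
qed

text \<open>Up to the sign \<open>(-1) ^ m\<close> this is Carlitz's D_m, the product of all monic
  polynomials of degree m.\<close>

definition bracket_prod :: "nat \<Rightarrow> 'a::{field,finite} fls" where
  "bracket_prod m = (\<Prod>k=1..m. (- bracket k) ^ (CARD('a) ^ (m - k)))"

lemma bracket_prod_Suc:
  "bracket_prod (Suc m) = bracket_prod m ^ CARD('a) * - (bracket (Suc m) :: 'a::{field,finite} fls)"
proof -
  have "(\<Prod>k=1..m. (- bracket k) ^ (CARD('a) ^ (Suc m - k))) =
      (\<Prod>k=1..m. ((- bracket k :: 'a fls) ^ (CARD('a) ^ (m - k))) ^ CARD('a))"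
    by (intro prod.cong) (simp_all add: Suc_diff_le mult.commute flip: power_mult)
  then show ?thesis by (simp add: bracket_prod_def prod_power_distrib)
qed

text \<open>Peeling off the first exponent leaves an inner value that is a power with exponent
  \<open>q ^ Suc j\<close>, so the sum is the \<open>q ^ j\<close>-th power of a telescoping one.
  The start \<open>j\<close> must stay general, as the tail begins at \<open>Suc j\<close>.\<close>

lemma truncated_multizeta_geometric:
  "truncated_multizeta (map (\<lambda>k. (CARD('a) - 1) * CARD('a) ^ k) [j..<j + m]) d =
     (carlitz_ratio m d / bracket_prod m :: 'a::{field,finite} fls) ^ (CARD('a) ^ j)"
proof (induction m arbitrary: j d)
  case 0
  then show ?case
    by (simp add: truncated_multizeta_Nil carlitz_ratio_def bracket_prod_def)
next
  case (Suc m)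
  let ?q = "CARD('a)"
  let ?t = "\<lambda>e. if m \<le> e then carlitz_l e / carlitz_l (e - m) ^ (?q ^ Suc m) else 0 :: 'a fls"
  have upt: "[j..<j + Suc m] = j # [Suc j..<Suc j + m]"
    by (simp add: upt_conv_Cons)
  \<comment> \<open>The q-1 inverse factors cancel against \<open>carlitz_l e ^ q\<close>, leaving
    the term of \<open>carlitz_ratio_sum\<close>.\<close>
  have summand: "inverse (carlitz_l e) ^ (?q - 1) * (carlitz_ratio m e / bracket_prod m) ^ ?q =
      ?t e / bracket_prod m ^ ?q" for e
  proof (cases "m \<le> e")
    case True
    have "inverse (carlitz_l e) ^ (?q - 1) * carlitz_l e ^ ?q =
        inverse (carlitz_l e) ^ (?q - 1) * (carlitz_l e :: 'a fls) ^ (?q - 1) * carlitz_l e"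
      by (metis mult.assoc power_minus_mult zero_less_card_finite)
    also have "\<dots> = carlitz_l e" by (simp flip: power_mult_distrib)
    finally have "inverse (carlitz_l e) ^ (?q - 1) * carlitz_l e ^ ?q = (carlitz_l e :: 'a fls)" .
    then show ?thesis
      using True
      by (simp add: carlitz_ratio_def power_divide power_mult_distrib mult.commute flip: power_mult)
  qed (simp add: carlitz_ratio_def power_0_left)
  have "truncated_multizeta (map (\<lambda>k. (?q - 1) * ?q ^ k) [j..<j + Suc m]) d =
      (\<Sum>e<d. power_sum e (int ((?q - 1) * ?q ^ j)) *
        (carlitz_ratio m e / bracket_prod m :: 'a fls) ^ (?q ^ Suc j))"
    unfolding upt list.map truncated_multizeta_Cons Suc.IH by (rule refl)
  also have "\<dots> = (\<Sum>e<d. (inverse (carlitz_l e) ^ (?q - 1) *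
        (carlitz_ratio m e / bracket_prod m) ^ ?q) ^ (?q ^ j))"
    unfolding power_sum_frobenius power_sum_card_minus_1
    by (simp only: power_mult_distrib power_Suc power_mult)
  also have "\<dots> = (\<Sum>e<d. ?t e / bracket_prod m ^ ?q) ^ (?q ^ j)"
    unfolding summand fls_frobenius_power_sum by (rule refl)
  also have "(\<Sum>e<d. ?t e / bracket_prod m ^ ?q) = (\<Sum>e<d. ?t e) / bracket_prod m ^ ?q"
    by (rule sum_divide_distrib[symmetric])
  also have "\<dots> = carlitz_ratio (Suc m) d / bracket_prod (Suc m)"
    unfolding carlitz_ratio_sum bracket_prod_Suc by (simp add: mult.commute)
  finally show ?case .
qed

text \<open>The numerator \<open>carlitz_l (Suc e)\<close> of S_e(q^2-1) makes the summand a term of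
  \<open>carlitz_ratio_sum\<close> at index e + 1; hence \<open>Suc d\<close> in the result.\<close>

lemma truncated_multizeta_tail:
  "truncated_multizeta ((CARD('a)\<^sup>2 - 1) # map (\<lambda>k. (CARD('a) - 1) * CARD('a) ^ k) [2..<n + 2]) d =
     carlitz_ratio (n + 2) (Suc d) /
     (bracket 1 * bracket (n + 2) * (bracket_prod n :: 'a::{field,finite} fls) ^ CARD('a)\<^sup>2)"
proof -
  let ?q = "CARD('a)"
  let ?c = "carlitz_l 1 * (bracket_prod n :: 'a fls) ^ ?q\<^sup>2"
  let ?t = "\<lambda>e. if Suc n \<le> e then carlitz_l e / carlitz_l (e - Suc n) ^ (?q ^ Suc (Suc n))
    else 0 :: 'a fls"
  have summand: "power_sum e (int (?q\<^sup>2 - 1)) * (carlitz_ratio n e / bracket_prod n) ^ ?q\<^sup>2 =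
      ?t (Suc e) / ?c" for e
    unfolding power_sum_card_sq_minus_1
    by (simp add: carlitz_ratio_def power_divide power2_eq_square mult_ac power_0_left flip: power_mult)
  have "truncated_multizeta ((?q\<^sup>2 - 1) # map (\<lambda>k. (?q - 1) * ?q ^ k) [2..<n + 2]) d =
      (\<Sum>e<d. power_sum e (int (?q\<^sup>2 - 1)) * (carlitz_ratio n e / bracket_prod n :: 'a fls) ^ ?q\<^sup>2)"
    using truncated_multizeta_geometric[of 2 n, where 'a = 'a]
    by (simp only: truncated_multizeta_Cons add.commute[of n 2])
  also have "\<dots> = (\<Sum>e<d. ?t (Suc e)) / ?c"
    unfolding summand by (rule sum_divide_distrib[symmetric])
  \<comment> \<open>The added term at index 0 is the default 0.\<close>
  also have "(\<Sum>e<d. ?t (Suc e)) = (\<Sum>e<Suc d. ?t e)"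
    unfolding sum.lessThan_Suc_shift by simp
  also have "\<dots> / ?c = carlitz_ratio (n + 2) (Suc d) /
      (bracket 1 * bracket (n + 2) * bracket_prod n ^ ?q\<^sup>2)"
    unfolding carlitz_ratio_sum using carlitz_l_Suc[of 0, where 'a = 'a]
    by (simp add: mult_ac)
  finally show ?thesis .
qed

section \<open>The outermost sum and its limit\<close>

lemma power_sum_card_power:
  "power_sum d (int (CARD('a) ^ N)) = inverse (carlitz_l d :: 'a::{field,finite} fls) ^ (CARD('a) ^ N)"
  using power_sum_frobenius[of d 1 N, where 'a = 'a] by (simp add: power_sum_1)

text \<open>Put N = n + 2 and let u_e be the power sum of exponent \<open>q ^ N\<close>. The term at
  d = e + N - 1 is -[e+N] u_e; since u_{e-1} = ([N] - [e+N]) u_e for positive e, it equals (1 - [N])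
  u_e + u_{e-1} - u_e, and the last two parts telescope.\<close>

lemma carlitz_ratio_weighted_sum:
  "(\<Sum>d<n + 2 + M. inverse (carlitz_l d) * carlitz_ratio (n + 2) (Suc d)) =
     (1 - bracket (n + 2)) * (\<Sum>e<Suc M. power_sum e (int (CARD('a) ^ (n + 2)))) -
     (power_sum M (int (CARD('a) ^ (n + 2))) :: 'a::{field,finite} fls)"
proof (induction M)
  case 0
  \<comment> \<open>Below d = n + 1 the ratio has its default value 0.\<close>
  have "(\<Sum>d<n + 2. inverse (carlitz_l d) * carlitz_ratio (n + 2) (Suc d)) =
      (\<Sum>d\<in>{Suc n}. inverse (carlitz_l d) * carlitz_ratio (n + 2) (Suc d) :: 'a fls)"
    by (intro sum.mono_neutral_right) (auto simp: carlitz_ratio_def)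
  also have "\<dots> = - bracket (n + 2)"
    using carlitz_l_Suc[of "Suc n", where 'a = 'a] by (simp add: carlitz_ratio_def)
  finally show ?case unfolding power_sum_card_power by simp
next
  case (Suc M)
  let ?N = "n + 2"
  define u where "u e = (power_sum e (int (CARD('a) ^ ?N)) :: 'a fls)" for e
  define B b :: "'a fls" where "B = bracket ?N" and "b = bracket (Suc M + ?N)"
  have uM: "u M = (B - b) * u (Suc M)"
  proof -
    have "carlitz_l (Suc M) ^ (CARD('a) ^ ?N) = (B - b) * (carlitz_l M :: 'a fls) ^ (CARD('a) ^ ?N)"
      unfolding carlitz_l_Suc_frobenius B_def b_def by (rule refl)
    moreover from this have "B - b \<noteq> 0" by (metis carlitz_l_nonzero mult_zero_left power_not_zero)
    ultimately show ?thesis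
      unfolding u_def power_sum_card_power power_inverse by simp
  qed
  have last: "inverse (carlitz_l (?N + M)) * carlitz_ratio ?N (Suc (?N + M)) = - b * u (Suc M)"
  proof -
    have "Suc (?N + M) - ?N = Suc M" by simp
    then have "carlitz_ratio ?N (Suc (?N + M)) =
        carlitz_l (Suc (?N + M)) * u (Suc M)"
      unfolding u_def power_sum_card_power
      by (simp add: carlitz_ratio_def power_inverse divide_inverse)
    then show ?thesis
      using carlitz_l_Suc[of "?N + M", where 'a = 'a] by (simp add: b_def add_ac)
  qed
  have "(\<Sum>d<?N + Suc M. inverse (carlitz_l d) * carlitz_ratio ?N (Suc d)) =
      (1 - B) * (\<Sum>e<Suc M. u e) - u M + - b * u (Suc M)"
    unfolding add_Suc_right sum.lessThan_Suc last Suc.IH[folded u_def B_def]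
    by (simp only: sum.lessThan_Suc)
  also have "\<dots> = (1 - B) * (\<Sum>e<Suc (Suc M). u e) - u (Suc M)"
    by (simp add: uM algebra_simps)
  finally show ?case by (simp only: u_def B_def)
qed

lemma multizeta_eq:
  defines "q \<equiv> CARD('a::{field,finite})"
  shows "multizeta (1 # (q\<^sup>2 - 1) # map (\<lambda>k. (q - 1) * q ^ k) [2..<n + 2]) =
    (1 - bracket (n + 2)) / (bracket 1 * bracket (n + 2) * (bracket_prod n :: 'a fls) ^ q\<^sup>2) *
    zeta (q ^ (n + 2))"
proof -
  let ?t = "(q\<^sup>2 - 1) # map (\<lambda>k. (q - 1) * q ^ k) [2..<n + 2]"
  let ?N = "n + 2"
  let ?u = "\<lambda>e. power_sum e (int (q ^ ?N)) :: 'a fls"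
  define C where "C = inverse (bracket 1 * bracket ?N * (bracket_prod n :: 'a fls) ^ q\<^sup>2)"
  have q: "q \<ge> 2" unfolding q_def by (rule card_field_ge_2)
  have trunc: "truncated_multizeta (1 # ?t) (M + ?N) =
      C * ((1 - bracket ?N) * (\<Sum>e<Suc M. ?u e) - ?u M)" for M
  proof -
    have "truncated_multizeta (1 # ?t) (M + ?N) =
        (\<Sum>d<?N + M. C * (inverse (carlitz_l d) * carlitz_ratio ?N (Suc d)))"
      unfolding truncated_multizeta_Cons[of 1] add.commute[of M] q_def truncated_multizeta_tail
      by (intro sum.cong refl) (simp add: power_sum_1 C_def q_def divide_inverse mult_ac)
    also have "\<dots> = C * (\<Sum>d<?N + M. inverse (carlitz_l d) * carlitz_ratio ?N (Suc d))"
      by (rule sum_distrib_left[symmetric])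
    finally show ?thesis unfolding carlitz_ratio_weighted_sum q_def .
  qed
  have "q\<^sup>2 > 1" using q by (intro one_less_power) auto
  then have "\<forall>x\<in>set (1 # ?t). x > 0" using q by auto
  then have lim: "(\<lambda>M. truncated_multizeta (1 # ?t) (M + ?N)) \<longlonglongrightarrow> (multizeta (1 # ?t) :: 'a fls)"
    by (intro LIMSEQ_ignore_initial_segment truncated_multizeta_tendsto)
  have "(\<lambda>M. \<Sum>e<Suc M. ?u e) \<longlonglongrightarrow> zeta (q ^ ?N)"
    using q by (intro LIMSEQ_Suc zeta_partial_sums_tendsto) simp
  \<comment> \<open>The boundary term vanishes in the limit: its coefficients below
    \<open>M * q ^ (n + 2)\<close> are 0.\<close>
  moreover have "?u \<longlonglongrightarrow> 0"
    unfolding tendsto_fls_iff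
  proof (intro allI eventually_sequentiallyI impI)
    fix m M :: nat and k :: int assume "m \<le> M" "k < int m"
    moreover have "1 \<le> q ^ ?N" using q by (intro one_le_power) simp
    then have "int M * 1 \<le> int M * int (q ^ ?N)" by (intro mult_left_mono) linarith+
    ultimately show "fls_nth (?u M) k = fls_nth 0 k"
      by (subst power_sum_nth_eq_0) auto
  qed
  ultimately have "(\<lambda>M. truncated_multizeta (1 # ?t) (M + ?N)) \<longlonglongrightarrow>
      C * ((1 - bracket ?N) * zeta (q ^ ?N) - 0)"
    unfolding trunc by (intro tendsto_fls_mult_left tendsto_fls_diff)
  with lim have "multizeta (1 # ?t) = C * ((1 - bracket ?N) * zeta (q ^ ?N) - 0)"
    by (rule LIMSEQ_unique)
  then show ?thesis by (simp add: C_def divide_inverse mult_ac)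
qed

subsection \<open>The coefficient is rational\<close>

lemma of_A_diff: "of_A (a - b) = of_A a - of_A b"
  by (rule fls_eqI) (simp add: of_A_nth)

lemma of_A_add: "of_A (a + b) = of_A a + of_A b"
  by (rule fls_eqI) (simp add: of_A_nth)

lemma of_A_smult: "of_A (smult c a) = fls_const c * of_A a"
  by (rule fls_eqI) (simp add: of_A_nth)

lemma of_A_mult: "of_A (a * b) = of_A a * of_A b"
  by (induction a) (simp_all add: of_A_pCons of_A_add of_A_smult algebra_simps)

lemma of_A_1: "of_A 1 = 1"
  by (simp add: one_pCons of_A_pCons)

lemma of_A_power: "of_A (a ^ k) = of_A a ^ k"
  by (induction k) (simp_all add: of_A_1 of_A_mult)

lemma of_A_prod: "of_A (\<Prod>x\<in>X. f x) = (\<Prod>x\<in>X. of_A (f x))"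
  by (induction X rule: infinite_finite_induct) (simp_all add: of_A_1 of_A_mult)

lemma of_A_bracket:
  "of_A ([:0, 1:] ^ (CARD('a) ^ k) - [:0, 1:]) = (bracket k :: 'a::{field,finite} fls)"
proof -
  have "of_A [:0, 1:] = (theta :: 'a fls)" by (simp add: of_A_pCons)
  then show ?thesis by (simp only: of_A_diff of_A_power bracket_def)
qed

text \<open>Powers with exponent \<open>q ^ j\<close> commute with negation in every characteristic,
  so each of the n factors contributes one sign.\<close>

lemma bracket_prod_frobenius:
  "bracket_prod n ^ CARD('a)\<^sup>2 =
     (-1) ^ n * (\<Prod>k=1..n. (bracket k :: 'a::{field,finite} fls) ^ (CARD('a) ^ (n + 2 - k)))"
proof -
  have "bracket_prod n ^ CARD('a)\<^sup>2 =
      (\<Prod>k=1..n. - ((bracket k :: 'a fls) ^ (CARD('a) ^ (n + 2 - k))))"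
    unfolding bracket_prod_def prod_power_distrib
  proof (rule prod.cong[OF refl])
    fix k assume "k \<in> {1..n}"
    then have "n + 2 - k = (n - k) + 2" by (simp add: Suc_diff_le)
    then have "CARD('a) ^ (n - k) * CARD('a)\<^sup>2 = CARD('a) ^ (n + 2 - k)"
      by (simp only: power_add)
    then show "((- bracket k) ^ CARD('a) ^ (n - k)) ^ CARD('a)\<^sup>2 =
        - ((bracket k :: 'a fls) ^ (CARD('a) ^ (n + 2 - k)))"
      by (simp only: power_mult[symmetric] fls_frobenius_power_uminus)
  qed
  also have "\<dots> = (-1) ^ n * (\<Prod>k=1..n. (bracket k :: 'a fls) ^ (CARD('a) ^ (n + 2 - k)))"
    by (simp add: prod_uminus)
  finally show ?thesis .
qed

text \<open>Each exponent \<open>(q - 1) * q ^ k\<close> is the gap between consecutive powers of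
  \<open>q\<close>, so the weight telescopes.\<close>

lemma sum_list_geometric:
  fixes q n :: nat
  assumes "q > 0"
  shows "q\<^sup>2 + sum_list (map (\<lambda>k. (q - 1) * q ^ k) [2..<n + 2]) = q ^ (n + 2)"
proof (induction n)
  case (Suc n)
  have "q ^ (n + 2) + (q - 1) * q ^ (n + 2) = q ^ (Suc n + 2)"
    by (cases q) (use assms in simp_all)
  moreover have "[2..<Suc n + 2] = [2..<n + 2] @ [n + 2]" by simp
  ultimately show ?case using Suc by (simp only: map_append sum_list_append) simp
qed (simp add: power2_eq_square)

theorem theorem4p5:
  fixes q n :: nat and s :: "nat list"
  assumes "q = CARD('a::{field,finite})" and "q > 2"
    and "s = [1, q\<^sup>2 - 1] @ map (\<lambda>k. (q - 1) * q ^ k) [2..<n + 2]"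
  shows "length s = n + 2 \<and> sum_list s = q ^ (n + 2) \<and>
    zeta_like TYPE('a) s \<and>
    (multizeta s :: 'a fls) =
      ((-1) ^ (n + 1) * (bracket (n + 2) - 1)) / (bracket 1 * bracket (n + 2))
      * (1 / (\<Prod>k=1..n. bracket k ^ (q ^ (n + 2 - k)))) * zeta (q ^ (n + 2))"
proof -
  let ?B = "bracket (n + 2) :: 'a fls"
  let ?P = "\<Prod>k=1..n. (bracket k :: 'a fls) ^ (q ^ (n + 2 - k))"
  let ?c = "((-1) ^ (n + 1) * (?B - 1)) / (bracket 1 * ?B) * (1 / ?P)"
  have len: "length s = n + 2" by (simp add: assms(3) del: upt_Suc)
  have "q\<^sup>2 \<ge> 1" using assms(2) by (intro one_le_power) simp
  then have weight: "sum_list s = q ^ (n + 2)"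
    using sum_list_geometric[of q n] assms(2,3) by (simp del: upt_Suc)
  have sign: "inverse ((-1) ^ n) = ((-1) ^ n :: 'a fls)"
    by (simp flip: power_inverse)
  have "multizeta s = (1 - ?B) / (bracket 1 * ?B * ((-1) ^ n * ?P)) * zeta (q ^ (n + 2))"
    using multizeta_eq[of n, where 'a = 'a] assms(1,3) by (simp only: bracket_prod_frobenius) simp
  also have "(1 - ?B) / (bracket 1 * ?B * ((-1) ^ n * ?P)) = ?c"
    by (simp add: divide_inverse sign algebra_simps)
  finally have eq: "multizeta s = ?c * zeta (q ^ (n + 2))" .
  have "zeta_like TYPE('a) s"
  proof -
    define b where "b k = [:0, 1:] ^ (q ^ k) - [:0, 1 :: 'a:]" for k
    define den where "den = b 1 * b (n + 2) * (\<Prod>k=1..n. b k ^ (q ^ (n + 2 - k)))"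
    have b: "of_A (b k) = bracket k" for k
      unfolding b_def assms(1) by (rule of_A_bracket)
    have den: "of_A den = bracket 1 * ?B * ?P"
      by (simp only: den_def of_A_mult of_A_prod of_A_power b)
    have "?P \<noteq> 0" by (simp add: bracket_nonzero)
    then have "bracket 1 * ?B * ?P \<noteq> 0" by (simp add: bracket_nonzero)
    then have "den \<noteq> 0" by (metis den of_A_0)
    \<comment> \<open>Writing -1 as \<open>0 - 1\<close> lets \<open>of_A_diff\<close> produce the
      sign.\<close>
    moreover have "?c = of_A ((0 - 1) ^ (n + 1) * (b (n + 2) - 1)) / of_A den"
      unfolding den by (simp only: of_A_mult of_A_power of_A_diff of_A_1 of_A_0 b) simp
    ultimately have c: "?c \<in> K_set" unfolding K_set_def by blast
    \<comment> \<open>If \<open>zeta\<close> were 0, the quotient would be 0 by the convention for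
      division, so that case requires 0 in \<open>K_set\<close>.\<close>
    have "0 = of_A 0 / of_A (1 :: 'a poly)" by simp
    then have "0 \<in> (K_set :: 'a fls set)"
      unfolding K_set_def by (metis (mono_tags, lifting) CollectI one_neq_zero)
    with c show ?thesis
      unfolding zeta_like_def weight eq by (cases "zeta (q ^ (n + 2)) = (0 :: 'a fls)") simp_all
  qed
  with len weight eq show ?thesis by blast
qed

end
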